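(* For all integers $n\ge 0$, $$\overline{R_{16,81}}(36n+33)\equiv 0 \pmod 8.$$
   Context: An overpartition of a nonnegative integer $n$ is a partition of $n$ (a non-increasing sequence of positive integers summing to $n$) in which the first occurrence of each part size may be overlined. For coprime positive integers $\ell,\mu$, $\overline{R_{\ell,\mu}}(n)$ denotes the number of overpartitions of $n$ in which no part is divisible by $\ell$ or by $\mu$ (with $\overline{R_{\ell,\mu}}(0)=1$). Its generating function, for $|q|<1$, is $$\sum_{n\ge 0}\overline{R_{\ell,\mu}}(n)q^n=\prod_{n=1}^{\infty}\frac{(1+q^{n})(1-q^{\ell n})(1-q^{\mu n})(1+q^{\ell\mu n})}{(1-q^{n})(1+q^{\ell n})(1+q^{\mu n})(1-q^{\ell\mu n})}.$$ The claim concerns $(\ell,\mu)=(16,81)$. *)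

theory Defs
  imports "HOL-Number_Theory.Cong"
begin

text \<open>A part is a pair of its size and a flag telling whether it is overlined.\<close>

definition overpartition :: "nat \<Rightarrow> (nat \<times> bool) list \<Rightarrow> bool" where
  "overpartition n ps \<longleftrightarrow>
     sorted_wrt (\<ge>) (map fst ps) \<and>
     (\<forall>p \<in> set ps. 0 < fst p) \<and>
     sum_list (map fst ps) = n \<and>
     (\<forall>j < length ps. snd (ps ! j) \<longrightarrow> (\<forall>i < j. fst (ps ! i) \<noteq> fst (ps ! j)))"

text \<open>The set counted here is finite, so \<^const>\<open>card\<close> is its true number of elements.\<close>

definition Rbar :: "nat \<Rightarrow> nat \<Rightarrow> nat \<Rightarrow> nat" where
  "Rbar l m n =
     card {ps. overpartition n ps \<and> (\<forall>p \<in> set ps. \<not> l dvd fst p \<and> \<not> m dvd fst p)}"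

lemma finite_overpartitions: "finite {ps. overpartition n ps}"
proof (rule finite_subset)
  show "{ps. overpartition n ps} \<subseteq> {ps. set ps \<subseteq> {..n} \<times> UNIV \<and> length ps \<le> n}"
  proof clarify
    fix ps :: "(nat \<times> bool) list"
    assume ps: "overpartition n ps"
    have sum: "sum_list (map fst ps) = n" and pos: "\<forall>p \<in> set ps. 0 < fst p"
      using ps by (auto simp: overpartition_def)
    have "fst p \<le> n" if "p \<in> set ps" for p
      using that member_le_sum_list[of "fst p" "map fst ps"] sum by auto
    moreover have "length ps \<le> sum_list (map fst ps)"
      using pos by (induction ps) auto
    ultimately show "set ps \<subseteq> {..n} \<times> UNIV \<and> length ps \<le> n"
      using sum by auto
  qed
  show "finite {ps :: (nat \<times> bool) list. set ps \<subseteq> {..n} \<times> UNIV \<and> length ps \<le> n}"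
    by (rule finite_lists_length_le) auto
qed

end

theory Submission
  imports Defs "HOL-Library.Multiset" "HOL-Library.FuncSet"
begin

text \<open>
  In an overpartition each part size that occurs may be overlined or not, on its first occurrence,
  so a partition with \<open>k\<close> distinct part sizes carries \<open>2 ^ k\<close> overpartitions. Modulo 8 only
  \<open>k = 1\<close> and \<open>k = 2\<close> survive, and \<open>Rbar 16 81 N\<close> is congruent to \<open>2 * A + 4 * B\<close>, where \<open>A\<close> and
  \<open>B\<close> count the partitions of \<open>N\<close> with exactly one and exactly two sizes, none divisible by 16 or
  81. It is enough that \<open>4 dvd A\<close> and that \<open>B\<close> is even.

  Write \<open>c(i)\<close> for the number of divisors of \<open>i\<close> that are divisible neither by 16 nor by 81. Then
  \<open>A = c(N)\<close>. A partition with two sizes is a representation \<open>N = a * x + b * y\<close> with \<open>b < a\<close>.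
  Counting all such representations without the condition \<open>b < a\<close> by the value \<open>i = a * x\<close>, and
  removing those with \<open>a = b\<close>, gives (\<open>two_sizes_count\<close>)
  \[ 2 B = \sum_{0 < i < N} c(i)\, c(N - i) - \sum_d (N / d - 1), \]
  where \<open>d\<close> runs over the divisors counted by \<open>c(N)\<close>. So three numbers have to be multiples of 4.

  Let \<open>N = 36 * n + 33 = 3 * m\<close>, where \<open>m = 12 * n + 11\<close>. Since \<open>m mod 3 = 2\<close>, it is not a square
  and has an even number of divisors; the divisors of \<open>N\<close> are the \<open>d\<close> and the \<open>3 * d\<close> with
  \<open>d dvd m\<close>, none of which is divisible by 16 or 81. This settles \<open>A\<close> and the subtracted sum
  (\<open>four_dvd_divisor_sums\<close>). In the convolution the terms \<open>i\<close> and \<open>N - i\<close> agree and are distinct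
  because \<open>N\<close> is odd, so it is enough that each term is even. If one were odd, then \<open>i\<close> and
  \<open>N - i\<close> would be squares (\<open>odd_card_divisors_imp_square\<close>), which is impossible because
  \<open>N mod 9 = 6\<close> and 6 is not a sum of two squares modulo 9.
\<close>

section \<open>Overpartitions as marked partitions\<close>

definition partitions_into :: "nat set \<Rightarrow> nat \<Rightarrow> nat list set" where
  "partitions_into D n = {xs. sorted_wrt (\<ge>) xs \<and> set xs \<subseteq> D \<and> sum_list xs = n}"

text \<open>The fourth clause of \<^const>\<open>overpartition\<close> on its own, so that it can be studied apart from
  the sizes.\<close>

definition first_marked :: "('a \<times> bool) list \<Rightarrow> bool" where
  "first_marked ps \<longleftrightarrow> (\<forall>j < length ps. snd (ps ! j) \<longrightarrow> (\<forall>i < j. fst (ps ! i) \<noteq> fst (ps ! j)))"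

lemma first_marked_snoc:
  "first_marked (ps @ [(x, b)]) \<longleftrightarrow> first_marked ps \<and> (b \<longrightarrow> x \<notin> set (map fst ps))"
proof -
  have "x \<notin> set (map fst ps) \<longleftrightarrow> (\<forall>i < length ps. fst (ps ! i) \<noteq> x)"
    by (metis in_set_conv_nth length_map nth_map)
  then show ?thesis
    unfolding first_marked_def by (auto simp: nth_append less_Suc_eq all_conj_distrib)
qed

text \<open>Appending a part \<open>x\<close> at the end leaves all earlier marks alone, and gives a free choice of mark
  exactly when \<open>x\<close> is a new size; hence one factor 2 for each distinct size.\<close>

lemma card_first_marked:
  "finite {ps. map fst ps = xs \<and> first_marked ps} \<and>
   card {ps. map fst ps = xs \<and> first_marked ps} = 2 ^ card (set xs)"
proof (induction xs rule: rev_induct)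
  case Nil
  have "{ps. map fst ps = [] \<and> first_marked ps} = {[] :: ('a \<times> bool) list}"
    by (auto simp: first_marked_def)
  then show ?case by simp
next
  case (snoc x xs)
  define M where "M = {ps. map fst ps = xs \<and> first_marked ps}"
  define F where "F = {b. b \<longrightarrow> x \<notin> set xs}"
  have eq: "{ps. map fst ps = xs @ [x] \<and> first_marked ps} = (\<lambda>(ps, b). ps @ [(x, b)]) ` (M \<times> F)"
  proof (intro equalityI subsetI)
    fix qs assume "qs \<in> {ps. map fst ps = xs @ [x] \<and> first_marked ps}"
    then have q: "map fst qs = xs @ [x]" "first_marked qs" by auto
    then obtain ps p where qs: "qs = ps @ [p]" by (cases qs rule: rev_cases) auto
    obtain y b where p: "p = (y, b)" by (cases p)
    have "map fst ps = xs" "y = x" using q(1) qs p by auto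
    then show "qs \<in> (\<lambda>(ps, b). ps @ [(x, b)]) ` (M \<times> F)"
      using q(2) qs p by (auto simp: first_marked_snoc M_def F_def image_iff)
  qed (auto simp: first_marked_snoc M_def F_def)
  have "inj_on (\<lambda>(ps, b). ps @ [(x, b)]) (M \<times> F)" by (auto simp: inj_on_def)
  then have "card ((\<lambda>(ps, b). ps @ [(x, b)]) ` (M \<times> F)) = card M * card F"
    by (simp add: card_image card_cartesian_product)
  moreover have "card F = (if x \<in> set xs then 1 else 2)"
  proof -
    have "F = (if x \<in> set xs then {False} else UNIV)" by (auto simp: F_def)
    then show ?thesis by (simp add: UNIV_bool)
  qed
  moreover have "finite M" "card M = 2 ^ card (set xs)" using snoc by (auto simp: M_def)
  ultimately show ?case unfolding eq by (auto simp: insert_absorb)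
qed

text \<open>Forgetting the marks maps overpartitions onto partitions, and the fibre over \<open>xs\<close> consists of
  the markings counted by \<open>card_first_marked\<close>.\<close>

lemma Rbar_eq_sum_partitions:
  assumes "D = {d. 0 < d \<and> \<not> l dvd d \<and> \<not> m dvd d}"
  shows "finite (partitions_into D n)"
    and "Rbar l m n = (\<Sum>xs\<in>partitions_into D n. 2 ^ card (set xs))"
proof -
  define R where
    "R = {ps. overpartition n ps \<and> (\<forall>p \<in> set ps. \<not> l dvd fst p \<and> \<not> m dvd fst p)}"
  define M where "M xs = {ps. map fst ps = xs \<and> first_marked ps}" for xs :: "nat list"
  have R: "R = (\<Union>xs\<in>partitions_into D n. M xs)"
  proof (intro equalityI subsetI)
    fix ps assume "ps \<in> R"
    then have "map fst ps \<in> partitions_into D n" "ps \<in> M (map fst ps)"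
      by (auto simp: R_def M_def partitions_into_def assms overpartition_def first_marked_def)
    then show "ps \<in> (\<Union>xs\<in>partitions_into D n. M xs)" by blast
  next
    fix ps assume "ps \<in> (\<Union>xs\<in>partitions_into D n. M xs)"
    then have ps: "map fst ps \<in> partitions_into D n" "first_marked ps" by (auto simp: M_def)
    have "fst p \<in> D" if "p \<in> set ps" for p
      using ps(1) that by (auto simp: partitions_into_def)
    then show "ps \<in> R"
      using ps by (auto simp: R_def partitions_into_def assms overpartition_def first_marked_def)
  qed
  have "finite R" unfolding R_def by (rule finite_subset[OF _ finite_overpartitions]) auto
  moreover have "partitions_into D n \<subseteq> map fst ` R"
  proof
    fix xs assume xs: "xs \<in> partitions_into D n"
    have "card (M xs) \<noteq> 0" using card_first_marked[of xs] by (simp add: M_def)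
    then obtain ps where "ps \<in> M xs" by fastforce
    then show "xs \<in> map fst ` R" using xs R by (auto simp: M_def)
  qed
  ultimately show fin: "finite (partitions_into D n)" by (meson finite_imageI finite_subset)
  have "card R = (\<Sum>xs\<in>partitions_into D n. card (M xs))"
    unfolding R by (rule card_UN_disjoint[OF fin]) (use card_first_marked in \<open>auto simp: M_def\<close>)
  then show "Rbar l m n = (\<Sum>xs\<in>partitions_into D n. 2 ^ card (set xs))"
    unfolding Rbar_def R_def[symmetric] by (simp add: M_def card_first_marked)
qed

lemma sum_two_power_mod_8:
  fixes c :: "'a \<Rightarrow> nat"
  assumes "finite P" "\<And>x. x \<in> P \<Longrightarrow> 0 < c x"
  shows "[(\<Sum>x\<in>P. 2 ^ c x) = 2 * card {x\<in>P. c x = 1} + 4 * card {x\<in>P. c x = 2}] (mod (8::nat))"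
proof -
  have "[(\<Sum>x\<in>P. 2 ^ c x) = (\<Sum>x\<in>P. 2 * of_bool (c x = 1) + 4 * of_bool (c x = 2))] (mod (8::nat))"
  proof (rule cong_sum)
    fix x assume "x \<in> P"
    then consider "c x = 1" | "c x = 2" | k where "c x = k + 3"
      using assms(2)[of x] by (metis One_nat_def Suc_1 add.commute add_Suc_shift less_numeral_extra(3) numeral_3_eq_3 old.nat.exhaust plus_1_eq_Suc)
    then show "[2 ^ c x = 2 * of_bool (c x = 1) + 4 * of_bool (c x = 2)] (mod (8::nat))"
      by cases (auto simp: cong_def power_add)
  qed
  also have "(\<Sum>x\<in>P. 2 * of_bool (c x = 1) + 4 * of_bool (c x = 2)) =
      2 * card {x\<in>P. c x = 1} + 4 * card {x\<in>P. c x = 2}"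
    using assms(1) by (simp add: sum.distrib flip: sum_distrib_left) (simp add: of_bool_def sum.If_cases Int_def)
  finally show ?thesis .
qed

section \<open>Partitions with one or two part sizes\<close>

definition divisors_in :: "nat set \<Rightarrow> nat \<Rightarrow> nat set" where
  "divisors_in D n = {d\<in>D. d dvd n}"

lemma finite_divisors_in: "0 < n \<Longrightarrow> finite (divisors_in D n)"
  unfolding divisors_in_def by simp

lemma card_one_size:
  assumes "0 < n" "0 \<notin> D"
  shows "card {xs \<in> partitions_into D n. card (set xs) = 1} = card (divisors_in D n)"
proof -
  have "bij_betw (\<lambda>d. replicate (n div d) d) (divisors_in D n)
          {xs \<in> partitions_into D n. card (set xs) = 1}"
  proof (rule bij_betwI[where g = hd])
    show "(\<lambda>d. replicate (n div d) d) \<in> divisors_in D n \<rightarrow> {xs \<in> partitions_into D n. card (set xs) = 1}"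
      using assms by (auto simp: divisors_in_def partitions_into_def sum_list_replicate sorted_wrt_iff_nth_less elim!: dvdE)
    have eq: "xs = replicate (length xs) (hd xs) \<and> n = length xs * hd xs \<and> hd xs \<in> D"
      if xs: "xs \<in> {xs \<in> partitions_into D n. card (set xs) = 1}" for xs
    proof -
      obtain a where a: "set xs = {a}" using xs by (auto simp: card_1_singleton_iff)
      then have rep: "xs = replicate (length xs) a" by (metis replicate_eqI singletonD)
      have "hd xs = a" using a by (metis hd_in_set set_empty singletonD insert_not_empty)
      moreover have "n = length xs * a"
        using xs rep by (metis (mono_tags, lifting) mem_Collect_eq partitions_into_def sum_list_replicate of_nat_id)
      ultimately show ?thesis using rep xs a by (auto simp: partitions_into_def)
    qed
    show "hd \<in> {xs \<in> partitions_into D n. card (set xs) = 1} \<rightarrow> divisors_in D n"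
    proof
      fix xs assume "xs \<in> {xs \<in> partitions_into D n. card (set xs) = 1}"
      from eq[OF this] show "hd xs \<in> divisors_in D n" by (metis (mono_tags, lifting) divisors_in_def dvd_triv_right mem_Collect_eq)
    qed
    show "hd (replicate (n div d) d) = d" if "d \<in> divisors_in D n" for d
      using that assms by (auto simp: divisors_in_def elim!: dvdE)
    show "replicate (n div hd xs) (hd xs) = xs"
      if "xs \<in> {xs \<in> partitions_into D n. card (set xs) = 1}" for xs
      using eq[OF that] assms by (metis nonzero_mult_div_cancel_right)
  qed
  then show ?thesis by (simp add: bij_betw_same_card)
qed

text \<open>The summand \<open>a * x\<close> stands for \<open>x\<close> copies of the part \<open>a\<close>. The quadruples are ordered and
  \<open>a = b\<close> is admitted, which makes their number a plain convolution.\<close>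

definition two_term_sums :: "nat set \<Rightarrow> nat \<Rightarrow> (nat \<times> nat \<times> nat \<times> nat) set" where
  "two_term_sums D n =
     {(a, x, b, y). a \<in> D \<and> b \<in> D \<and> 0 < x \<and> 0 < y \<and> a * x + b * y = n}"

lemma descending_list_unique:
  fixes xs ys :: "'a::linorder list"
  assumes "sorted_wrt (\<ge>) xs" "sorted_wrt (\<ge>) ys" "mset xs = mset ys"
  shows "xs = ys"
proof -
  have "sorted (rev xs)" "sorted (rev ys)" using assms by (simp_all add: sorted_wrt_rev)
  then have "rev xs = rev ys" using assms(3)
    by (metis mset_rev sorted_sort_id sort_key_eq_sort_key properties_for_sort)
  then show ?thesis by simp
qed

lemma descending_two_blocks:
  fixes a b :: nat
  assumes "b < a"
  shows "sorted_wrt (\<ge>) (replicate x a @ replicate y b)"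
proof -
  have "sorted_wrt (\<ge>) (replicate k c)" for k and c :: nat by (induction k) auto
  then show ?thesis using assms by (auto simp: sorted_wrt_append)
qed

text \<open>A partition with two sizes is a block of copies of the larger size followed by a block of copies
  of the smaller one.\<close>

lemma card_two_sizes:
  "card {xs \<in> partitions_into D n. card (set xs) = 2} =
   card {(a, x, b, y) \<in> two_term_sums D n. b < a}"
proof -
  define f where "f = (\<lambda>(a::nat, x, b, y). replicate x a @ replicate y b)"
  have inj: "inj_on f {(a, x, b, y) \<in> two_term_sums D n. b < a}"
  proof (rule inj_onI)
    fix p p'
    assume "p \<in> {(a, x, b, y) \<in> two_term_sums D n. b < a}"
      "p' \<in> {(a, x, b, y) \<in> two_term_sums D n. b < a}"
      and eq: "f p = f p'"
    then obtain a x b y a' x' b' y' where p: "p = (a, x, b, y)" "p' = (a', x', b', y')"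
      and *: "(a, x, b, y) \<in> two_term_sums D n" "b < a"
        "(a', x', b', y') \<in> two_term_sums D n" "b' < a'"
      by auto
    have pos: "0 < x" "0 < y" "0 < x'" "0 < y'" using * by (auto simp: two_term_sums_def)
    have eq': "replicate x a @ replicate y b = replicate x' a' @ replicate y' b'"
      using eq by (simp add: f_def p)
    have "hd (replicate x a @ replicate y b) = a" "hd (replicate x' a' @ replicate y' b') = a'"
      "last (replicate x a @ replicate y b) = b" "last (replicate x' a' @ replicate y' b') = b'"
      using pos by (auto simp: hd_append)
    then have ab: "a = a'" "b = b'" using eq' by auto
    have "count (mset (replicate x a @ replicate y b)) a = x" "count (mset (replicate x' a' @ replicate y' b')) a = x'"
      "count (mset (replicate x a @ replicate y b)) b = y" "count (mset (replicate x' a' @ replicate y' b')) b = y'"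
      using * ab by auto
    then have "x = x'" "y = y'" using eq' by auto
    then show "p = p'" using ab p by simp
  qed
  have img: "f ` {(a, x, b, y) \<in> two_term_sums D n. b < a} =
      {xs \<in> partitions_into D n. card (set xs) = 2}"
  proof (intro equalityI subsetI)
    fix xs assume "xs \<in> f ` {(a, x, b, y) \<in> two_term_sums D n. b < a}"
    then obtain a x b y where xs: "xs = replicate x a @ replicate y b"
      and q: "(a, x, b, y) \<in> two_term_sums D n" "b < a" by (auto simp: f_def)
    then have "set xs = {a, b}" by (auto simp: two_term_sums_def)
    moreover have "sorted_wrt (\<ge>) xs"
      unfolding xs by (rule descending_two_blocks[OF q(2)])
    moreover have "sum_list xs = n"
      using q by (simp add: xs two_term_sums_def sum_list_replicate mult.commute)
    ultimately show "xs \<in> {xs \<in> partitions_into D n. card (set xs) = 2}"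
      using q by (auto simp: partitions_into_def two_term_sums_def)
  next
    fix xs assume xs: "xs \<in> {xs \<in> partitions_into D n. card (set xs) = 2}"
    then obtain a b where ab: "set xs = {a, b}" "b < a"
      by (auto simp: card_2_iff) (metis insert_commute nat_neq_iff)
    define x where "x = count (mset xs) a"
    define y where "y = count (mset xs) b"
    have m: "mset xs = mset (replicate x a @ replicate y b)"
    proof (rule multiset_eqI)
      fix z show "count (mset xs) z = count (mset (replicate x a @ replicate y b)) z"
      proof (cases "z \<in> {a, b}")
        case True then show ?thesis using ab(2) by (auto simp: x_def y_def)
      next
        case False
        then have "z \<notin> set xs" using ab(1) by simp
        then show ?thesis using False by (simp add: count_mset_0_iff)
      qed
    qed
    have "xs = replicate x a @ replicate y b"
    proof (rule descending_list_unique[OF _ _ m])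
      show "sorted_wrt (\<ge>) xs" using xs by (simp add: partitions_into_def)
      show "sorted_wrt (\<ge>) (replicate x a @ replicate y b)"
        by (rule descending_two_blocks[OF ab(2)])
    qed
    moreover have "0 < x" "0 < y"
      using ab(1) unfolding x_def y_def by (metis count_greater_zero_iff insertI1 insert_commute set_mset_mset)+
    moreover from calculation have "a * x + b * y = n"
      using xs by (auto simp: partitions_into_def sum_list_replicate mult.commute)
    ultimately have "(a, x, b, y) \<in> two_term_sums D n"
      using xs ab(1) by (auto simp: two_term_sums_def partitions_into_def)
    then show "xs \<in> f ` {(a, x, b, y) \<in> two_term_sums D n. b < a}"
      using \<open>xs = _\<close> ab(2) by (force simp: f_def)
  qed
  show ?thesis unfolding img[symmetric] by (rule card_image[OF inj])
qed

text \<open>For fixed \<open>i = a * x\<close>, the sizes \<open>a\<close> and \<open>b\<close> are arbitrary divisors of \<open>i\<close> and \<open>n - i\<close>, and they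
  determine the multiplicities \<open>x\<close> and \<open>y\<close>.\<close>

lemma card_two_term_sums:
  assumes "0 \<notin> D"
  shows "finite (two_term_sums D n)"
    and "card (two_term_sums D n) =
      (\<Sum>i\<in>{0<..<n}. card (divisors_in D i) * card (divisors_in D (n - i)))"
proof -
  define S where "S = (SIGMA i:{0<..<n}. divisors_in D i \<times> divisors_in D (n - i))"
  have bij: "bij_betw (\<lambda>(i, a, b). (a, i div a, b, (n - i) div b)) S (two_term_sums D n)"
    using assms
    by (intro bij_betwI[where g = "\<lambda>(a, x, b, y). (a * x, a, b)"])
       (auto simp: S_def two_term_sums_def divisors_in_def intro!: gr0I elim!: dvdE split: if_splits)
  have "finite S" unfolding S_def by (intro finite_SigmaI) (auto intro: finite_divisors_in)
  then show "finite (two_term_sums D n)" using bij bij_betw_finite by blast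
  have "card S = (\<Sum>i\<in>{0<..<n}. card (divisors_in D i) * card (divisors_in D (n - i)))"
    unfolding S_def
    by (subst card_SigmaI) (auto simp: finite_divisors_in card_cartesian_product)
  then show "card (two_term_sums D n) =
      (\<Sum>i\<in>{0<..<n}. card (divisors_in D i) * card (divisors_in D (n - i)))"
    using bij_betw_same_card[OF bij] by simp
qed

text \<open>If \<open>a = b = d\<close>, the equation reads \<open>x + y = n div d\<close>, with \<open>n div d - 1\<close> positive solutions.\<close>

lemma card_equal_sizes:
  assumes "0 \<notin> D" "0 < n"
  shows "card {(a, x, b, y) \<in> two_term_sums D n. a = b} = (\<Sum>d\<in>divisors_in D n. n div d - 1)"
proof -
  define S where "S = (SIGMA d:divisors_in D n. {0<..<n div d})"
  have bij: "bij_betw (\<lambda>(d, x). (d, x, d, n div d - x)) S {(a, x, b, y) \<in> two_term_sums D n. a = b}"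
    using assms
    by (intro bij_betwI[where g = "\<lambda>(a, x, b, y). (a, x)"])
       (auto simp: S_def two_term_sums_def divisors_in_def distrib_left[symmetric] elim!: dvdE)
  have "card S = (\<Sum>d\<in>divisors_in D n. n div d - 1)"
    unfolding S_def by (subst card_SigmaI) (auto intro: finite_divisors_in[OF assms(2)])
  then show ?thesis using bij_betw_same_card[OF bij] by simp
qed

text \<open>Exchanging the two summands matches the quadruples with \<open>b < a\<close> and those with \<open>a < b\<close>, so
  each partition with two sizes is counted twice; the quadruples with \<open>a = b\<close> remain.\<close>

lemma two_sizes_count:
  assumes "0 \<notin> D" "0 < n"
  shows "(\<Sum>i\<in>{0<..<n}. card (divisors_in D i) * card (divisors_in D (n - i))) =
    2 * card {xs \<in> partitions_into D n. card (set xs) = 2} + (\<Sum>d\<in>divisors_in D n. n div d - 1)"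
proof -
  define T where "T = two_term_sums D n"
  define L where "L = {(a, x, b, y) \<in> T. b < a}"
  define G where "G = {(a, x, b, y) \<in> T. a < b}"
  define E where "E = {(a, x, b, y) \<in> T. a = b}"
  have T: "T = (L \<union> G) \<union> E" "L \<inter> G = {}" "(L \<union> G) \<inter> E = {}"
    by (auto simp: L_def G_def E_def)
  have fin: "finite T" using card_two_term_sums(1)[OF assms(1)] by (simp add: T_def)
  then have "finite L" "finite G" "finite E" using T(1) by auto
  then have "card T = card L + card G + card E"
    using T by (simp add: card_Un_disjoint)
  moreover have "bij_betw (\<lambda>(a, x, b, y). (b, y, a, x)) L G"
    by (intro bij_betwI[where g = "\<lambda>(a, x, b, y). (b, y, a, x)"])
       (auto simp: L_def G_def T_def two_term_sums_def)
  then have "card G = card L" by (simp add: bij_betw_same_card)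
  ultimately show ?thesis
    using card_two_term_sums(2)[OF assms(1), of n] card_equal_sizes[OF assms] card_two_sizes[of D n]
    by (simp add: T_def L_def E_def)
qed

section \<open>Parity of divisor counts\<close>

text \<open>The map \<open>d \<mapsto> n div d\<close> exchanges the divisors below and above the square root of \<open>n\<close>.\<close>

lemma even_card_divisors:
  fixes n :: nat
  assumes "0 < n" "\<nexists>s. n = s * s"
  shows "even (card {d. d dvd n})"
proof -
  define L where "L = {d. d dvd n \<and> d * d < n}"
  define G where "G = {d. d dvd n \<and> n < d * d}"
  have "bij_betw (\<lambda>d. n div d) L G"
    using assms(1)
    by (intro bij_betwI[where g = "\<lambda>d. n div d"]) (auto simp: L_def G_def elim!: dvdE)
  then have "card L = card G" by (rule bij_betw_same_card)
  moreover have "{d. d dvd n} = L \<union> G" "L \<inter> G = {}"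
    using assms(2) by (auto simp: L_def G_def neq_iff)
  moreover have "finite L" "finite G" using assms(1) by (simp_all add: L_def G_def)
  ultimately show ?thesis by (simp add: card_Un_disjoint)
qed

text \<open>Write \<open>i = p ^ a * u\<close> with \<open>u\<close> prime to \<open>p\<close>. As \<open>a \<ge> 4\<close>, the exponent of \<open>p\<close> in such a divisor
  can be any of 0, 1, 2, 3, independently of its part dividing \<open>u\<close>: their number is a multiple
  of 4.\<close>

lemma even_card_divisors_avoiding:
  fixes p q i :: nat
  assumes p: "prime p" and q: "coprime p q" and i: "0 < i" "p ^ 4 dvd i"
  shows "even (card {d. d dvd i \<and> \<not> p ^ 4 dvd d \<and> \<not> q dvd d})"
proof -
  define a where "a = multiplicity p i"
  have unit: "\<not> is_unit p" using p by (simp add: prime_nat_iff)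
  then obtain u where u: "i = p ^ a * u" "\<not> p dvd u"
    using multiplicity_decompose'[of i p] i(1) unfolding a_def by (metis neq0_conv)
  have a: "4 \<le> a" using i unit unfolding a_def by (intro multiplicity_geI) auto
  define W where "W = {e. e dvd u \<and> \<not> q dvd e}"
  have cop: "coprime (p ^ k) q" "coprime (p ^ k) u" for k
    using q p u(2) by (simp_all add: prime_imp_coprime)
  have p_ndvd: "\<not> p dvd e" if "e \<in> W" for e using that u(2) by (auto simp: W_def)
  have p0: "p \<noteq> 0" using p by auto
  have eq: "{d. d dvd i \<and> \<not> p ^ 4 dvd d \<and> \<not> q dvd d} = (\<lambda>(k, e). p ^ k * e) ` ({..<4} \<times> W)"
  proof (intro equalityI subsetI)
    fix d assume "d \<in> {d. d dvd i \<and> \<not> p ^ 4 dvd d \<and> \<not> q dvd d}"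
    then have d: "d dvd i" "\<not> p ^ 4 dvd d" "\<not> q dvd d" by auto
    then have "d \<noteq> 0" using i by auto
    then obtain e where e: "d = p ^ multiplicity p d * e" "\<not> p dvd e"
      using multiplicity_decompose'[of d p] unit by metis
    define k where "k = multiplicity p d"
    have de: "d = p ^ k * e" using e(1) by (simp add: k_def)
    have "k < 4" using d(2) de by (metis dvd_mult2 le_imp_power_dvd not_less)
    moreover have "e dvd p ^ a * u" using d(1) de u(1) dvd_mult_right by metis
    then have "e dvd u" using e(2) p by (metis coprime_commute coprime_dvd_mult_right_iff coprime_power_right_iff prime_imp_coprime)
    moreover have "\<not> q dvd e" using d(3) de by auto
    ultimately show "d \<in> (\<lambda>(k, e). p ^ k * e) ` ({..<4} \<times> W)" using de by (auto simp: W_def)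
  next
    fix d assume "d \<in> (\<lambda>(k, e). p ^ k * e) ` ({..<4} \<times> W)"
    then obtain k e where d: "d = p ^ k * e" "k < 4" "e dvd u" "\<not> q dvd e" "\<not> p dvd e"
      using p_ndvd by (auto simp: W_def)
    have "d dvd i" unfolding d(1) u(1) using d(2,3) a by (intro mult_dvd_mono le_imp_power_dvd) auto
    moreover have "\<not> p ^ 4 dvd d"
    proof
      assume "p ^ 4 dvd d"
      then have "p ^ Suc k dvd p ^ k * e" using d(1,2) by (metis Suc_leI dvd_trans le_imp_power_dvd)
      then show False using d(5) p0 by simp
    qed
    moreover have "\<not> q dvd d" using d(1,4) cop by (simp add: coprime_dvd_mult_right_iff coprime_commute)
    ultimately show "d \<in> {d. d dvd i \<and> \<not> p ^ 4 dvd d \<and> \<not> q dvd d}" by simp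
  qed
  have "inj_on (\<lambda>(k, e). p ^ k * e) ({..<4} \<times> W)"
  proof (rule inj_onI)
    fix r r'
    assume "r \<in> {..<4} \<times> W" "r' \<in> {..<4} \<times> W"
      and "(\<lambda>(k, e). p ^ k * e) r = (\<lambda>(k, e). p ^ k * e) r'"
    then obtain k e k' e' where r: "r = (k, e)" "r' = (k', e')"
      and *: "e \<in> W" "e' \<in> W" "p ^ k * e = p ^ k' * e'" by auto
    have "multiplicity p (p ^ k * e) = k" "multiplicity p (p ^ k' * e') = k'"
      using p_ndvd[OF *(1)] p_ndvd[OF *(2)] p by (simp_all add: multiplicity_decomposeI)
    then have "k = k'" using *(3) by simp
    then show "r = r'" using *(3) p0 r by simp
  qed
  then show ?thesis unfolding eq by (simp add: card_image card_cartesian_product)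
qed

definition parts_16_81 :: "nat set" where
  "parts_16_81 = {d. 0 < d \<and> \<not> 16 dvd d \<and> \<not> 81 dvd d}"

text \<open>If 16 or 81 divides \<open>i\<close>, the count is even by \<open>even_card_divisors_avoiding\<close>, with \<open>p = 2\<close> or
  \<open>p = 3\<close>. Otherwise all divisors of \<open>i\<close> are counted, and their number is odd only for squares.\<close>

lemma odd_card_divisors_imp_square:
  assumes i: "0 < i" and odd: "odd (card (divisors_in parts_16_81 i))"
  shows "\<exists>s. i = s * s"
proof -
  have D: "divisors_in parts_16_81 i = {d. d dvd i \<and> \<not> 16 dvd d \<and> \<not> 81 dvd d}"
    using i by (auto simp: divisors_in_def parts_16_81_def)
  have "\<not> 16 dvd i"
  proof
    assume "16 dvd i"
    moreover have "coprime (2 :: nat) 81" by simp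
    ultimately have "even (card {d. d dvd i \<and> \<not> 2 ^ 4 dvd d \<and> \<not> 81 dvd d})"
      using i by (intro even_card_divisors_avoiding) simp_all
    then show False using odd by (simp add: D)
  qed
  moreover have "\<not> 81 dvd i"
  proof
    assume "81 dvd i"
    moreover have "coprime (3 :: nat) (2 ^ 4)" unfolding coprime_power_right_iff by simp
    ultimately have "even (card {d. d dvd i \<and> \<not> 3 ^ 4 dvd d \<and> \<not> 2 ^ 4 dvd d})"
      using i by (intro even_card_divisors_avoiding) simp_all
    moreover have "{d. d dvd i \<and> \<not> 3 ^ 4 dvd d \<and> \<not> 2 ^ 4 dvd d} = divisors_in parts_16_81 i"
      unfolding D by auto
    ultimately show False using odd by simp
  qed
  ultimately have "divisors_in parts_16_81 i = {d. d dvd i}"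
    unfolding D using dvd_trans by blast
  then show ?thesis using even_card_divisors[OF i] odd by auto
qed

lemma sum_squares_mod_9_neq_6:
  fixes s t :: nat
  shows "(s * s + t * t) mod 9 \<noteq> 6"
proof -
  have sq: "s * s mod 9 \<in> {0, 1, 4, 7}" for s :: nat
  proof -
    have "s mod 9 \<in> {..<9}" by simp
    then have "s mod 9 \<in> {0, 1, 2, 3, 4, 5, 6, 7, 8}" by auto
    then have "(s mod 9) * (s mod 9) mod 9 \<in> {0, 1, 4, 7}" by auto
    then show ?thesis by (simp only: mod_mult_eq)
  qed
  show ?thesis using sq[of s] sq[of t] by (auto simp: mod_add_eq[of "s * s" 9 "t * t", symmetric])
qed

lemma square_mod_3_neq_2:
  fixes s :: nat
  shows "s * s mod 3 \<noteq> 2"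
proof -
  have "s mod 3 \<in> {..<3}" by simp
  then have "s mod 3 \<in> {0, 1, 2}" by auto
  then have "(s mod 3) * (s mod 3) mod 3 \<noteq> 2" by auto
  then show ?thesis unfolding mod_mult_eq .
qed

section \<open>Divisibility by four and the congruence\<close>

text \<open>As \<open>n\<close> is odd, \<open>i \<mapsto> n - i\<close> has no fixed point, so the sum is twice a sum of even numbers.\<close>

lemma four_dvd_symmetric_sum:
  fixes f :: "nat \<Rightarrow> nat"
  assumes "odd n" "\<And>i. 0 < i \<Longrightarrow> i < n \<Longrightarrow> even (f i)"
    and "\<And>i. 0 < i \<Longrightarrow> i < n \<Longrightarrow> f (n - i) = f i"
  shows "4 dvd (\<Sum>i\<in>{0<..<n}. f i)"
proof -
  define L where "L = {i. 0 < i \<and> 2 * i < n}"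
  define G where "G = {i. n < 2 * i \<and> i < n}"
  have "2 * i < n \<or> n < 2 * i" for i using assms(1) by (metis dvd_triv_left nat_neq_iff)
  then have split: "{0<..<n} = L \<union> G" "L \<inter> G = {}" by (force simp: L_def G_def)+
  moreover have fin: "finite L" "finite G" using split(1) by (metis finite_Un finite_greaterThanLessThan)+
  moreover have "(\<Sum>i\<in>G. f i) = (\<Sum>i\<in>L. f i)"
    by (rule sum.reindex_bij_witness[of _ "\<lambda>i. n - i" "\<lambda>i. n - i"])
       (auto simp: L_def G_def assms(3))
  ultimately have "(\<Sum>i\<in>{0<..<n}. f i) = 2 * (\<Sum>i\<in>L. f i)" by (simp add: sum.union_disjoint)
  moreover have "even (\<Sum>i\<in>L. f i)" by (rule dvd_sum) (use assms(2) in \<open>auto simp: L_def\<close>)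
  ultimately show ?thesis by auto
qed

lemma divisors_three_times:
  fixes m :: nat
  assumes "\<not> 3 dvd m"
  shows "{d. d dvd 3 * m} = {d. d dvd m} \<union> (*) 3 ` {d. d dvd m}"
    and "{d. d dvd m} \<inter> (*) 3 ` {d. d dvd m} = {}"
proof -
  have p3: "prime (3::nat)" by simp
  show "{d. d dvd 3 * m} = {d. d dvd m} \<union> (*) 3 ` {d. d dvd m}"
  proof (intro equalityI subsetI)
    fix d assume d: "d \<in> {d. d dvd 3 * m}"
    show "d \<in> {d. d dvd m} \<union> (*) 3 ` {d. d dvd m}"
    proof (cases "3 dvd d")
      case True then show ?thesis using d by (auto elim!: dvdE)
    next
      case False
      then have "coprime d 3" using p3 by (metis coprime_commute prime_imp_coprime)
      then show ?thesis using d by (simp add: coprime_dvd_mult_right_iff)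
    qed
  qed auto
  show "{d. d dvd m} \<inter> (*) 3 ` {d. d dvd m} = {}" using assms dvd_mult_left by fastforce
qed

text \<open>Each \<open>d dvd m\<close> yields the two divisors \<open>d\<close> and \<open>3 * d\<close> of \<open>3 * m\<close>, whose contributions to the
  second sum add up to \<open>(3 * (m div d) - 1) + (m div d - 1) = 4 * (m div d) - 2\<close>. The number of
  such \<open>d\<close> is even because \<open>m\<close> is not a square, so the terms \<open>- 2\<close> also add up to a multiple
  of 4.\<close>

lemma four_dvd_divisor_sums:
  fixes m :: nat
  assumes m: "m mod 3 = 2"
  shows "4 dvd card {d. d dvd 3 * m}"
    and "4 dvd (\<Sum>d | d dvd 3 * m. 3 * m div d - 1)"
proof -
  define V where "V = {d. d dvd m}"
  have m0: "0 < m" "\<not> 3 dvd m" using m by (auto intro!: gr0I simp: dvd_eq_mod_eq_0)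
  have fin: "finite V" using m0 by (simp add: V_def)
  have "\<nexists>s. m = s * s" using square_mod_3_neq_2 m by metis
  then have even: "even (card V)" using even_card_divisors[OF m0(1)] by (simp add: V_def)
  note split = divisors_three_times[OF m0(2), folded V_def]
  have inj: "inj_on ((*) (3::nat)) V" by (auto simp: inj_on_def)
  have "card {d. d dvd 3 * m} = 2 * card V"
    using split fin inj by (simp add: card_Un_disjoint card_image)
  then show "4 dvd card {d. d dvd 3 * m}" using even by auto
  have "(\<Sum>d | d dvd 3 * m. 3 * m div d - 1) = (\<Sum>d\<in>V. (3 * m div d - 1) + (m div d - 1))"
    using split fin by (simp add: sum.union_disjoint sum.reindex[OF inj] sum.distrib)
  \<comment> \<open>The constants are moved to the left, because subtraction truncates.\<close>
  also have "\<dots> + (\<Sum>d\<in>V. 2) = (\<Sum>d\<in>V. 4 * (m div d))"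
    unfolding sum.distrib[symmetric]
  proof (rule sum.cong[OF refl])
    fix d assume "d \<in> V"
    then obtain c where c: "m = d * c" by (auto simp: V_def)
    then have "0 < d" "0 < c" using m0 by auto
    then show "(3 * m div d - 1) + (m div d - 1) + 2 = 4 * (m div d)"
      using c by (simp add: mult.left_commute[of 3])
  qed
  finally have "(\<Sum>d | d dvd 3 * m. 3 * m div d - 1) + 2 * card V = 4 * (\<Sum>d\<in>V. m div d)"
    by (simp add: sum_distrib_left)
  moreover have "4 dvd 2 * card V" using even by auto
  ultimately show "4 dvd (\<Sum>d | d dvd 3 * m. 3 * m div d - 1)"
    by (metis dvd_add_left_iff dvd_triv_left)
qed

theorem theorem7p1:
  fixes n :: nat
  shows "[Rbar 16 81 (36 * n + 33) = 0] (mod 8)"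
proof -
  define m where "m = 12 * n + 11"
  define N where "N = 3 * m"
  define D where "D = parts_16_81"
  define A where "A = card {xs \<in> partitions_into D N. card (set xs) = 1}"
  define B where "B = card {xs \<in> partitions_into D N. card (set xs) = 2}"
  have N: "N = 36 * n + 33" "0 < N" by (simp_all add: N_def m_def)
  have D0: "0 \<notin> D" by (simp add: D_def parts_16_81_def)
  have "0 < card (set xs)" if "xs \<in> partitions_into D N" for xs
    using that N(2) by (cases xs) (auto simp: partitions_into_def card_gt_0_iff)
  then have Rbar: "[Rbar 16 81 N = 2 * A + 4 * B] (mod 8)"
    using sum_two_power_mod_8[of "partitions_into D N" "\<lambda>xs. card (set xs)"]
      Rbar_eq_sum_partitions[of D 16 81 N] by (simp add: A_def B_def D_def parts_16_81_def)
  have N9: "N mod 9 = 6" unfolding N(1) by presburger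
  have "odd N" unfolding N(1) by simp
  then have "\<not> 16 dvd N" by (metis dvd_trans dvd_triv_left mult_2 numeral_Bit0)
  moreover have "\<not> 9 dvd N" using N9 by presburger
  then have "\<not> 81 dvd N" using dvd_trans[of 9 81 N] by auto
  ultimately have "0 < d \<and> \<not> 16 dvd d \<and> \<not> 81 dvd d" if "d dvd N" for d
    using that N(2) by (meson dvd_pos_nat dvd_trans)
  then have div: "divisors_in D N = {d. d dvd 3 * m}"
    by (auto simp: divisors_in_def D_def parts_16_81_def N_def)
  have m: "m mod 3 = 2" unfolding m_def by presburger
  have A: "4 dvd A"
    using four_dvd_divisor_sums(1)[OF m] card_one_size[OF N(2) D0] div by (simp add: A_def)
  have E: "4 dvd (\<Sum>d\<in>divisors_in D N. N div d - 1)"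
    using four_dvd_divisor_sums(2)[OF m] div by (simp add: N_def)
  have "4 dvd (\<Sum>i\<in>{0<..<N}. card (divisors_in D i) * card (divisors_in D (N - i)))"
  proof (rule four_dvd_symmetric_sum)
    show "odd N" by fact
    fix i assume i: "0 < i" "i < N"
    show "card (divisors_in D (N - i)) * card (divisors_in D (N - (N - i))) =
        card (divisors_in D i) * card (divisors_in D (N - i))" using i by simp
    show "even (card (divisors_in D i) * card (divisors_in D (N - i)))"
    proof (rule ccontr)
      assume "odd (card (divisors_in D i) * card (divisors_in D (N - i)))"
      then obtain s t where "i = s * s" "N - i = t * t"
        using odd_card_divisors_imp_square i unfolding D_def by (meson even_mult_iff zero_less_diff)
      then have "N = s * s + t * t" using i by simp
      then show False using sum_squares_mod_9_neq_6 N9 by metis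
    qed
  qed
  then have "4 dvd 2 * B"
    using two_sizes_count[OF D0 N(2)] E by (metis B_def dvd_add_left_iff)
  then have "8 dvd 2 * A + 4 * B" using A by presburger
  then show ?thesis using Rbar N(1) by (metis cong_0_iff cong_trans)
qed

end
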